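(* Let $A$ be a complex unital Banach algebra with unit $\mathbf 1$ such that the spectrum $\sigma(x)$ is totally disconnected for every $x\in A$. Let $\phi:A\to\mathbb C$ be a function (not assumed linear or multiplicative) such that (P1) $\phi(x)\phi(y)\in\sigma(xy)$ for all $x,y\in A$; (P2) $\phi(\mathbf 1)=1$; (P3) $\phi$ is continuous on $A$. Then $\phi$ is a character of $A$.
   Context: For $x\in A$, $\sigma(x)=\{\lambda\in\mathbb C:\lambda\mathbf 1-x\notin G(A)\}$, where $G(A)$ is the group of invertible elements of $A$. A character of $A$ is a linear functional $\chi:A\to\mathbb C$ which is multiplicative, i.e. $\chi(xy)=\chi(x)\chi(y)$ for all $x,y\in A$. *)

theory Defs
  imports "HOL-Analysis.Analysis"
begin

text \<open>
  The library's \<open>real_normed_algebra_1\<close> and \<open>banach\<close> provide a complete real normed algebra with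
  \<open>norm (x * y) \<le> norm x * norm y\<close> and \<open>norm 1 = 1\<close>. The class below adds a complex scalar
  multiplication extending the real one. The multiplication is not assumed commutative.
\<close>

class complex_banach_algebra_1 = real_normed_algebra_1 + banach +
  fixes scaleC :: "complex \<Rightarrow> 'a \<Rightarrow> 'a" (infixr \<open>*\<^sub>C\<close> 75)
  assumes scaleC_add_right: "c *\<^sub>C (x + y) = c *\<^sub>C x + c *\<^sub>C y"
    and scaleC_add_left: "(c + d) *\<^sub>C x = c *\<^sub>C x + d *\<^sub>C x"
    and scaleC_scaleC: "c *\<^sub>C (d *\<^sub>C x) = (c * d) *\<^sub>C x"
    and scaleC_one: "1 *\<^sub>C x = x"
    and scaleC_of_real: "complex_of_real r *\<^sub>C x = r *\<^sub>R x"
    and scaleC_mult_left: "(c *\<^sub>C x) * y = c *\<^sub>C (x * y)"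
    and scaleC_mult_right: "x * (c *\<^sub>C y) = c *\<^sub>C (x * y)"
    and norm_scaleC: "norm (c *\<^sub>C x) = cmod c * norm x"

definition invertibles :: "'a::complex_banach_algebra_1 set" where
  "invertibles = {x. \<exists>y. x * y = 1 \<and> y * x = 1}"

definition spectrum :: "'a::complex_banach_algebra_1 \<Rightarrow> complex set" where
  "spectrum x = {c. c *\<^sub>C 1 - x \<notin> invertibles}"

definition totally_disconnected :: "'a::topological_space set \<Rightarrow> bool" where
  "totally_disconnected S \<longleftrightarrow> (\<forall>C\<in>components S. \<exists>a. C = {a})"

text \<open>
  As a character is only required to be linear and multiplicative, the zero functional is one.
\<close>

definition character :: "('a::complex_banach_algebra_1 \<Rightarrow> complex) \<Rightarrow> bool" where
  "character f \<longleftrightarrow>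
     Vector_Spaces.linear scaleC (*) f \<and> (\<forall>x y. f (x * y) = f x * f y)"

end

theory Submission
  imports Defs
begin

text \<open>
  If \<open>g\<close> is a continuous path of invertible elements, then \<open>\<phi> (x g) * \<phi> (g\<^sup>-\<^sup>1)\<close> is a continuous path in
  \<open>\<sigma>(x)\<close>, hence constant, and \<open>\<phi> (g\<^sup>-\<^sup>1) = 1 / \<phi> g\<close> because \<open>\<sigma>(1) = {1}\<close>. Complements of closed totally
  disconnected plane sets are connected and dense, so for \<open>g(\<mu>) = \<mu>1 - y\<close> with \<open>\<mu>\<close> in the resolvent set
  the constant can be evaluated at infinity, and continuity extends \<open>\<phi> (x g(\<mu>)) = \<phi> x * \<phi> (g(\<mu>))\<close> to all \<open>\<mu>\<close>;
  thus \<open>\<phi>\<close> is multiplicative. Finally \<open>\<mu> - \<phi> (\<mu>1 - x)\<close> is a continuous path in \<open>\<sigma>(x)\<close>, which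
  gives \<open>\<phi> (1 + x) = 1 + \<phi> x\<close>, and additivity follows on the dense set of invertible elements by factoring.
\<close>

section \<open>Topology of totally disconnected sets\<close>

lemma totally_disconnected_continuous_constant:
  fixes f :: "'a::topological_space \<Rightarrow> 'b::topological_space"
  assumes "totally_disconnected T" "connected S" "continuous_on S f" "f ` S \<subseteq> T"
    and "x \<in> S" "y \<in> S"
  shows "f x = f y"
proof -
  have "connected (f ` S)"
    using assms connected_continuous_image by blast
  moreover have "T \<noteq> {}"
    using assms(4,5) by auto
  ultimately obtain C where "C \<in> components T" "f ` S \<subseteq> C"
    using exists_component_superset assms(4) by metis
  moreover obtain a where "C = {a}"
    using assms(1) \<open>C \<in> components T\<close> unfolding totally_disconnected_def by auto
  ultimately show ?thesis
    using assms(5,6) by auto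
qed

text \<open>If a closed set separates the space, so does one of its components; here components are
  points, which do not separate in dimension at least 2.\<close>

lemma connected_Compl_totally_disconnected:
  fixes S :: "'a::euclidean_space set"
  assumes "closed S" "totally_disconnected S" "2 \<le> DIM('a)"
  shows "connected (- S)"
proof (rule ccontr)
  assume "\<not> connected (- S)"
  then obtain C where C: "C \<in> components S" "\<not> connected (- C)"
    using separation_by_component_closed assms(1) by blast
  then obtain a where "C = {a}"
    using assms(2) unfolding totally_disconnected_def by auto
  then show False
    using C(2) connected_punctured_universe[OF assms(3)] by simp
qed

text \<open>A ball inside \<open>S\<close> would be connected, hence a single point, and points are
  not open in a perfect space.\<close>

lemma closure_Compl_totally_disconnected:
  fixes S :: "'a::{real_normed_vector, perfect_space} set"
  assumes "totally_disconnected S"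
  shows "closure (- S) = UNIV"
proof -
  have "interior S = {}"
  proof (rule ccontr)
    assume "interior S \<noteq> {}"
    then obtain a e where e: "e > 0" "ball a e \<subseteq> S"
      using mem_interior by blast
    have "x = a" if "x \<in> ball a e" for x
      using totally_disconnected_continuous_constant[OF assms connected_ball continuous_on_id, of a e]
        e that by simp
    then have "ball a e = {a}"
      using e by auto
    then show False
      by (metis open_ball not_open_singleton)
  qed
  then show ?thesis
    by (simp add: closure_complement)
qed

section \<open>Complex scalar multiplication\<close>

lemma bounded_linear_scaleC_left:
  "bounded_linear (\<lambda>c. c *\<^sub>C (x::'a::complex_banach_algebra_1))"
proof (rule bounded_linear_intro[where K = "norm x"])
  show "(r *\<^sub>R c) *\<^sub>C x = r *\<^sub>R (c *\<^sub>C x)" for r c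
    using scaleC_scaleC[of "of_real r" c x] by (simp add: scaleC_of_real scaleR_conv_of_real)
qed (simp_all add: scaleC_add_left norm_scaleC)

lemmas continuous_on_scaleC [continuous_intros] =
  bounded_linear.continuous_on[OF bounded_linear_scaleC_left]
lemmas tendsto_scaleC [tendsto_intros] =
  bounded_linear.tendsto[OF bounded_linear_scaleC_left]

lemma scaleC_zero_left [simp]: "0 *\<^sub>C (x::'a::complex_banach_algebra_1) = 0"
  using scaleC_of_real[of 0 x] by simp

lemma scaleC_diff_right: "c *\<^sub>C (x - y) = c *\<^sub>C x - c *\<^sub>C (y::'a::complex_banach_algebra_1)"
  using scaleC_add_right[of c "x - y" y] by simp

lemma scaleC_diff_left: "(c - d) *\<^sub>C x = c *\<^sub>C x - d *\<^sub>C (x::'a::complex_banach_algebra_1)"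
  using scaleC_add_left[of "c - d" d x] by simp

section \<open>Invertible elements and the spectrum\<close>

lemma invertibles_mult:
  assumes "x \<in> invertibles" "y \<in> invertibles"
  shows "x * y \<in> invertibles"
proof -
  obtain x' y' where "x * x' = 1" "x' * x = 1" "y * y' = 1" "y' * y = 1"
    using assms unfolding invertibles_def by blast
  then have "x * y * (y' * x') = 1 \<and> y' * x' * (x * y) = 1"
    by (metis mult.assoc mult_1_left)
  then show ?thesis
    unfolding invertibles_def by blast
qed

lemma invertibles_scaleC_iff:
  assumes "c \<noteq> 0"
  shows "c *\<^sub>C x \<in> invertibles \<longleftrightarrow> x \<in> invertibles"
proof -
  have sc: "d *\<^sub>C y \<in> invertibles" if "y \<in> invertibles" "d \<noteq> 0" for d and y :: 'a
  proof -
    obtain y' where "y * y' = 1" "y' * y = 1"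
      using \<open>y \<in> invertibles\<close> unfolding invertibles_def by blast
    then have "d *\<^sub>C y * (inverse d *\<^sub>C y') = 1 \<and> inverse d *\<^sub>C y' * (d *\<^sub>C y) = 1"
      using \<open>d \<noteq> 0\<close> by (simp add: scaleC_mult_left scaleC_mult_right scaleC_scaleC scaleC_one)
    then show ?thesis
      unfolding invertibles_def by blast
  qed
  show ?thesis
    using sc[of x c] sc[of "c *\<^sub>C x" "inverse c"] assms
    by (auto simp: scaleC_scaleC scaleC_one)
qed

text \<open>The Neumann series \<open>?s\<close> is a two-sided inverse.\<close>

lemma one_minus_in_invertibles:
  fixes x :: "'a::complex_banach_algebra_1"
  assumes "norm x < 1"
  shows "1 - x \<in> invertibles"
proof -
  let ?s = "\<Sum>n. x ^ n"
  have s: "summable (\<lambda>n. x ^ n)"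
    by (rule complete_algebra_summable_geometric[OF assms])
  have "x * ?s = (\<Sum>n. x ^ Suc n)" "?s * x = (\<Sum>n. x ^ Suc n)"
    using suminf_mult[OF s, of x] suminf_mult2[OF s, of x] by (simp_all add: power_commutes)
  moreover have "(\<Sum>n. x ^ Suc n) = ?s - 1"
    using suminf_split_head[OF s] by simp
  ultimately have "(1 - x) * ?s = 1 \<and> ?s * (1 - x) = 1"
    by (simp add: left_diff_distrib right_diff_distrib)
  then show ?thesis
    unfolding invertibles_def by blast
qed

text \<open>Near an invertible \<open>g\<close> with inverse \<open>g'\<close>, write
  \<open>h = g * (1 - g' * (g - h))\<close>; the second factor is covered by the Neumann series once
  \<open>h\<close> is within \<open>1 / norm g'\<close> of \<open>g\<close>.\<close>

lemma open_invertibles: "open (invertibles :: 'a::complex_banach_algebra_1 set)"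
  unfolding open_dist
proof
  fix g :: 'a
  assume g: "g \<in> invertibles"
  then obtain g' where g': "g * g' = 1" "g' * g = 1"
    unfolding invertibles_def by blast
  then have "norm g' > 0"
    by auto
  have "h \<in> invertibles" if "dist h g < 1 / norm g'" for h
  proof -
    have "norm (g' * (g - h)) \<le> norm g' * norm (g - h)"
      by (rule norm_mult_ineq)
    also have "\<dots> < 1"
      using that \<open>norm g' > 0\<close> by (simp add: dist_norm norm_minus_commute field_simps)
    finally have "g * (1 - g' * (g - h)) \<in> invertibles"
      using g by (intro invertibles_mult one_minus_in_invertibles)
    also have "g * (1 - g' * (g - h)) = h"
      by (simp add: right_diff_distrib g' flip: mult.assoc)
    finally show ?thesis .
  qed
  then show "\<exists>e>0. \<forall>h. dist h g < e \<longrightarrow> h \<in> invertibles"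
    using \<open>norm g' > 0\<close> by (intro exI[of _ "1 / norm g'"]) auto
qed

lemma Compl_spectrum: "- spectrum x = {c. c *\<^sub>C 1 - x \<in> invertibles}"
  unfolding spectrum_def by auto

lemma closed_spectrum: "closed (spectrum x)"
proof -
  have "open ((\<lambda>c. c *\<^sub>C 1 - x) -` invertibles)"
    by (intro open_vimage open_invertibles continuous_intros)
  then show ?thesis
    by (simp add: closed_def Compl_spectrum vimage_def)
qed

lemma norm_less_not_in_spectrum:
  assumes "norm x < cmod c"
  shows "c \<notin> spectrum x"
proof -
  have "c \<noteq> 0"
    using assms by auto
  have "1 - inverse c *\<^sub>C x \<in> invertibles"
    using assms \<open>c \<noteq> 0\<close>
    by (intro one_minus_in_invertibles) (simp add: norm_scaleC norm_inverse norm_divide divide_simps)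
  then have "c *\<^sub>C (1 - inverse c *\<^sub>C x) \<in> invertibles"
    using \<open>c \<noteq> 0\<close> by (simp add: invertibles_scaleC_iff)
  then show ?thesis
    using \<open>c \<noteq> 0\<close> by (simp add: spectrum_def scaleC_diff_right scaleC_scaleC scaleC_one)
qed

text \<open>This determines \<phi> on scalars and, with \<open>c = 1\<close>, its values on inverse
  pairs through \<open>P1\<close>.\<close>

lemma spectrum_scaleC_one: "spectrum (c *\<^sub>C 1 :: 'a::complex_banach_algebra_1) \<subseteq> {c}"
proof
  fix d
  assume d: "d \<in> spectrum (c *\<^sub>C 1 :: 'a)"
  have "(1::'a) \<in> invertibles"
    unfolding invertibles_def by auto
  then have "d - c = 0"
    using d invertibles_scaleC_iff[of "d - c" "1::'a"]
    by (auto simp: spectrum_def scaleC_diff_left)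
  then show "d \<in> {c}"
    by simp
qed

lemma diff_in_spectrum:
  assumes "c \<in> spectrum (d *\<^sub>C 1 - x)"
  shows "d - c \<in> spectrum x"
proof -
  have "c *\<^sub>C 1 - (d *\<^sub>C 1 - x) = (- 1) *\<^sub>C ((d - c) *\<^sub>C 1 - x)"
    using scaleC_of_real[of "- 1" "(d - c) *\<^sub>C 1 - x"] by (simp add: scaleC_diff_left)
  then show ?thesis
    using assms by (simp add: spectrum_def invertibles_scaleC_iff)
qed

section \<open>Multiplicativity and linearity of \<phi>\<close>

theorem theorem2p4:
  fixes \<phi> :: "'a::complex_banach_algebra_1 \<Rightarrow> complex"
  assumes "\<And>x::'a. totally_disconnected (spectrum x)"
    and P1: "\<And>x y. \<phi> x * \<phi> y \<in> spectrum (x * y)"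
    and P2: "\<phi> 1 = 1"
    and P3: "continuous_on UNIV \<phi>"
  shows "character \<phi>"
proof -
  note td = assms(1)
  note cont = continuous_on_compose2[OF P3 _ subset_UNIV]
  have isCont: "isCont \<phi> x" for x
    using P3 by (simp add: continuous_on_eq_continuous_at)

  have in_spec: "\<phi> x \<in> spectrum x" for x
    using P1[of x 1] P2 by simp
  have scalar: "\<phi> (c *\<^sub>C 1) = c" for c
    using in_spec[of "c *\<^sub>C 1"] spectrum_scaleC_one by blast

  have hom: "\<phi> (c *\<^sub>C x) = c * \<phi> x" if "c \<noteq> 0" for c x
  proof -
    \<comment> \<open>The two arguments multiply to \<open>x\<close>, so \<open>P1\<close> keeps
      \<open>?f\<close> in the spectrum of \<open>x\<close>; by \<open>scalar\<close> its second
      factor is \<open>inverse c\<close>.\<close>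
    let ?f = "\<lambda>c. \<phi> (c *\<^sub>C x) * \<phi> (inverse c *\<^sub>C 1)"
    have "?f c = ?f 1"
    proof (rule totally_disconnected_continuous_constant[where f = ?f, OF td[of x]])
      show "connected (- {0::complex})"
        by (simp add: connected_punctured_universe)
      show "continuous_on (- {0}) ?f"
        by (intro continuous_intros cont) auto
      have "?f d \<in> spectrum x" if "d \<noteq> 0" for d
        using P1[of "d *\<^sub>C x" "inverse d *\<^sub>C 1"] that
        by (simp add: scaleC_mult_left scaleC_mult_right scaleC_scaleC scaleC_one)
      then show "?f ` (- {0}) \<subseteq> spectrum x"
        by auto
    qed (use that in auto)
    then show ?thesis
      using that by (simp add: P2 scalar scaleC_one field_simps)
  qed

  have inv: "\<phi> g * \<phi> g' = 1" if "g * g' = 1" for g g'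
    using P1[of g g'] that spectrum_scaleC_one[of 1] by (auto simp: scaleC_one)

  have mult_resolvent: "\<phi> (x * (c *\<^sub>C 1 - y)) = \<phi> x * \<phi> (c *\<^sub>C 1 - y)" if "c \<notin> spectrum y" for c x y
  proof -
    let ?g = "\<lambda>c. c *\<^sub>C 1 - y"
    \<comment> \<open>Dividing by \<open>\<phi> (?g c)\<close> is multiplying by \<phi> of the
      inverse of \<open>?g c\<close>, so \<open>P1\<close> applies to a product equal to
      \<open>x\<close>.\<close>
    let ?f = "\<lambda>c. \<phi> (x * ?g c) / \<phi> (?g c)"
    have g: "\<phi> (?g d) \<noteq> 0 \<and> ?f d \<in> spectrum x" if d: "d \<in> - spectrum y" for d
    proof -
      obtain h where h: "?g d * h = 1"
        using d unfolding Compl_spectrum invertibles_def by blast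
      have "\<phi> (x * ?g d) * \<phi> h \<in> spectrum x"
        using P1[of "x * ?g d" h] by (simp add: mult.assoc h)
      moreover have "\<phi> h = 1 / \<phi> (?g d)" "\<phi> (?g d) \<noteq> 0"
        using inv[OF h] by (auto simp add: eq_divide_eq mult.commute)
      ultimately show ?thesis
        by simp
    qed
    have const: "?f d = ?f c" if "d \<notin> spectrum y" for d
    proof (rule totally_disconnected_continuous_constant[where f = ?f, OF td[of x]])
      show "connected (- spectrum y)"
        by (intro connected_Compl_totally_disconnected closed_spectrum td) simp
      show "continuous_on (- spectrum y) ?f"
        using g by (intro continuous_intros cont) auto
    qed (use g \<open>c \<notin> spectrum y\<close> that in auto)
    \<comment> \<open>This is \<open>?g (of_nat n)\<close> divided by \<open>n\<close>. By
      \<open>hom\<close> the factor \<open>n\<close> cancels in \<open>?f\<close>, so the constant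
      can be read off from \<open>?u\<close>, which tends to 1.\<close>
    let ?u = "\<lambda>n. 1 - inverse (of_nat n) *\<^sub>C y"
    have "\<forall>\<^sub>F n in sequentially. n > 0 \<and> real n > norm y"
      using filterlim_real_sequentially eventually_gt_at_top
      by (auto simp: filterlim_at_top_dense intro!: eventually_conj)
    then have ev: "\<forall>\<^sub>F n in sequentially. \<phi> (x * ?u n) = ?f c * \<phi> (?u n)"
    proof eventually_elim
      case (elim n)
      then have gn: "?g (of_nat n) = of_nat n *\<^sub>C ?u n"
        by (simp add: scaleC_diff_right scaleC_scaleC scaleC_one)
      have n: "of_nat n \<notin> spectrum y"
        using elim by (intro norm_less_not_in_spectrum) simp
      show ?case
        using const[OF n] g[of "of_nat n"] n elim
        by (simp add: gn hom scaleC_mult_right field_simps)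
    qed
    have u: "?u \<longlonglongrightarrow> 1 - 0 *\<^sub>C y"
      by (intro tendsto_intros lim_inverse_n)
    have lim: "(\<lambda>n. \<phi> (x * ?u n)) \<longlonglongrightarrow> \<phi> (x * (1 - 0 *\<^sub>C y))"
      by (intro isCont_tendsto_compose[OF isCont] tendsto_mult tendsto_const u)
    have "(\<lambda>n. ?f c * \<phi> (?u n)) \<longlonglongrightarrow> ?f c * \<phi> (1 - 0 *\<^sub>C y)"
      by (intro isCont_tendsto_compose[OF isCont] tendsto_mult tendsto_const u)
    then have "\<phi> (x * (1 - 0 *\<^sub>C y)) = ?f c * \<phi> (1 - 0 *\<^sub>C y)"
      by (rule LIMSEQ_unique[OF Lim_transform_eventually[OF lim ev]])
    then have "\<phi> x = ?f c"
      using P2 by simp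
    then show ?thesis
      using g[of c] that by (simp add: field_simps)
  qed

  \<comment> \<open>The sign is chosen so that \<open>c = 0\<close> gives \<open>y\<close> itself: a
    closed condition on \<open>c\<close> that holds on the dense resolvent set of \<open>- y\<close>
    also holds at 0.\<close>
  have resolvent_dense: "P y" if "closed {c. P (c *\<^sub>C 1 - (- y))}"
    "\<And>c. c \<notin> spectrum (- y) \<Longrightarrow> P (c *\<^sub>C 1 - (- y))" for P and y :: 'a
  proof -
    have "closure (- spectrum (- y)) \<subseteq> {c. P (c *\<^sub>C 1 - (- y))}"
      using that by (intro closure_minimal) auto
    then have "P (0 *\<^sub>C 1 - (- y))"
      using closure_Compl_totally_disconnected[OF td[of "- y"]] by blast
    then show ?thesis
      by simp
  qed

  have mult: "\<phi> (x * y) = \<phi> x * \<phi> y" for x y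
  proof (rule resolvent_dense[where P = "\<lambda>y. \<phi> (x * y) = \<phi> x * \<phi> y"])
    show "closed {c. \<phi> (x * (c *\<^sub>C 1 - (- y))) = \<phi> x * \<phi> (c *\<^sub>C 1 - (- y))}"
      by (intro closed_Collect_eq continuous_intros cont)
  qed (rule mult_resolvent)

  have translate: "\<phi> (1 + x) = 1 + \<phi> x" for x
  proof -
    \<comment> \<open>By \<open>in_spec\<close> and \<open>diff_in_spectrum\<close> this path stays
      in the spectrum of \<open>- x\<close> over the whole plane; its values at 1 and 0 are
      \<open>1 - \<phi> (1 + x)\<close> and \<open>- \<phi> x\<close>.\<close>
    let ?f = "\<lambda>c. c - \<phi> (c *\<^sub>C 1 - (- x))"
    have "?f 1 = ?f 0"
    proof (rule totally_disconnected_continuous_constant[where f = ?f, OF td[of "- x"] connected_UNIV])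
      show "continuous_on UNIV ?f"
        by (intro continuous_intros cont)
      show "range ?f \<subseteq> spectrum (- x)"
        using in_spec diff_in_spectrum by blast
    qed auto
    then show ?thesis
      by (simp add: scaleC_one algebra_simps)
  qed

  have add: "\<phi> (x + y) = \<phi> x + \<phi> y" for x y
  proof (rule resolvent_dense[where P = "\<lambda>y. \<phi> (x + y) = \<phi> x + \<phi> y"])
    fix c
    assume "c \<notin> spectrum (- y)"
    then obtain h where h: "(c *\<^sub>C 1 - (- y)) * h = 1"
      unfolding spectrum_def invertibles_def by blast
    let ?g = "c *\<^sub>C 1 - (- y)"
    \<comment> \<open>Factoring out the invertible \<open>?g\<close> leaves a sum with 1, to which
      \<open>translate\<close> applies; \<open>inv\<close> then removes
      \<open>\<phi> ?g * \<phi> h\<close>.\<close>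
    have "x + ?g = ?g * (1 + h * x)"
      by (simp only: distrib_left h mult_1_left mult_1_right add.commute flip: mult.assoc)
    then have "\<phi> (x + ?g) = \<phi> ?g * (1 + \<phi> h * \<phi> x)"
      by (simp only: mult translate)
    then show "\<phi> (x + ?g) = \<phi> x + \<phi> ?g"
      using inv[OF h] by (simp add: distrib_left flip: mult.assoc)
  next
    show "closed {c. \<phi> (x + (c *\<^sub>C 1 - (- y))) = \<phi> x + \<phi> (c *\<^sub>C 1 - (- y))}"
      by (intro closed_Collect_eq continuous_intros cont)
  qed

  have "\<phi> 0 = 0"
    using scalar[of 0] by simp
  then have "\<phi> (c *\<^sub>C x) = c * \<phi> x" for c x
    using hom[of c x] by (cases "c = 0") auto
  then have "Vector_Spaces.linear scaleC (*) \<phi>"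
    by unfold_locales
      (auto simp: add scaleC_add_right scaleC_add_left scaleC_scaleC scaleC_one algebra_simps)
  then show ?thesis
    by (simp add: character_def mult)
qed

end
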